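(* Let $F:\bar I\to\mathbb{R}$ and $G:\mathbb{R}\to\mathbb{R}$ be such that $F(\lambda)-G(x)>0$ and $F'(\lambda)>0$ for all $(x,\lambda)\in\mathbb{R}\times I$. Then the functions $$H(t,x,\lambda)=\frac{F'(\lambda)}{\sqrt{F(\lambda)-G(x)}},\qquad \tilde u(t,x,\lambda)=\sqrt{F(\lambda)-G(x)}$$ are stationary solutions of $$\partial_tH+\partial_x(H\tilde u)=0,\qquad \partial_t\tilde u+\tilde u\,\partial_x\tilde u+g\,\partial_x\int_0^1H\,\mathrm{d}\lambda=-g\,\partial_xz_b\qquad\text{in }\mathbb{R}\times I,$$ provided the topography satisfies $$z_b(x)=\frac{G(x)}{2g}-2\sqrt{F(1)-G(x)}+2\sqrt{F(0)-G(x)}.$$ Moreover the quantities $h=\int_0^1H\,\mathrm{d}\lambda$, $\eta=z_b+h$ and $\phi=z_b+\int_0^\lambda H\,\mathrm{d}\lambda$ are given explicitly by $$h=2\sqrt{F(1)-G(x)}-2\sqrt{F(0)-G(x)},\qquad \eta=\frac{G(x)}{2g},$$ $$\phi=\frac{G(x)}{2g}+2\sqrt{F(\lambda)-G(x)}-2\sqrt{F(1)-G(x)}.$$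
   Context: $I=(0,1)$, $\bar I=[0,1]$, $g>0$ is the gravity constant. $F$ and $G$ are assumed regular enough (e.g. $F$ is $C^1$ on $\bar I$, $G$ differentiable, and the resulting functions $H$, $\tilde u$, $z_b$ differentiable in $x$) for the equations to make sense classically. *)

theory Defs
  imports "HOL-Analysis.Analysis"
begin

text \<open>
  Functions of time, horizontal position and vertical label have the argument order
  \<open>t\<close>, \<open>x\<close>, \<open>\<lambda>\<close>. The label ranges over the open unit interval; values at the two
  endpoints do not influence any of the integrals over closed intervals below.
\<close>

definition depth :: "(real \<Rightarrow> real \<Rightarrow> real \<Rightarrow> real) \<Rightarrow> real \<Rightarrow> real \<Rightarrow> real" where
  "depth H t x = integral {0..1} (\<lambda>l. H t x l)"

definition free_surface ::
    "(real \<Rightarrow> real) \<Rightarrow> (real \<Rightarrow> real \<Rightarrow> real \<Rightarrow> real) \<Rightarrow> real \<Rightarrow> real \<Rightarrow> real" where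
  "free_surface zb H t x = zb x + depth H t x"

definition layer_height ::
    "(real \<Rightarrow> real) \<Rightarrow> (real \<Rightarrow> real \<Rightarrow> real \<Rightarrow> real) \<Rightarrow> real \<Rightarrow> real \<Rightarrow> real \<Rightarrow> real" where
  "layer_height zb H t x l = zb x + integral {0..l} (\<lambda>m. H t x m)"

text \<open>
  Classical solutions: \<open>deriv\<close> and \<open>integral\<close> are total in HOL, so the existence of every
  partial derivative and of the (Lebesgue) integral occurring in the equations is required
  explicitly.
\<close>

definition classical_solution ::
    "real \<Rightarrow> (real \<Rightarrow> real) \<Rightarrow> (real \<Rightarrow> real \<Rightarrow> real \<Rightarrow> real) \<Rightarrow>
      (real \<Rightarrow> real \<Rightarrow> real \<Rightarrow> real) \<Rightarrow> bool" where
  "classical_solution g zb H u \<longleftrightarrow>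
    (\<forall>t x. (\<lambda>l. H t x l) absolutely_integrable_on {0..1} \<and>
      (\<lambda>y. depth H t y) differentiable (at x) \<and>
      zb differentiable (at x) \<and>
      (\<forall>l\<in>{0<..<1}.
        (\<lambda>s. H s x l) differentiable (at t) \<and>
        (\<lambda>y. H t y l) differentiable (at x) \<and>
        (\<lambda>s. u s x l) differentiable (at t) \<and>
        (\<lambda>y. u t y l) differentiable (at x) \<and>
        deriv (\<lambda>s. H s x l) t + deriv (\<lambda>y. H t y l * u t y l) x = 0 \<and>
        deriv (\<lambda>s. u s x l) t + u t x l * deriv (\<lambda>y. u t y l) x
          + g * deriv (\<lambda>y. depth H t y) x = - g * deriv zb x))"

definition stationary_solution ::
    "real \<Rightarrow> (real \<Rightarrow> real) \<Rightarrow> (real \<Rightarrow> real \<Rightarrow> real \<Rightarrow> real) \<Rightarrow>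
      (real \<Rightarrow> real \<Rightarrow> real \<Rightarrow> real) \<Rightarrow> bool" where
  "stationary_solution g zb H u \<longleftrightarrow>
    classical_solution g zb H u \<and>
    (\<forall>s t x. \<forall>l\<in>{0<..<1}. H s x l = H t x l \<and> u s x l = u t x l)"

end

theory Submission
  imports Defs
begin

text \<open>
  The antiderivative of \<open>H\<close> in \<open>\<lambda>\<close> is \<open>2 * sqrt (F \<lambda> - G x)\<close>, which gives all the integrals, and in
  particular \<open>depth H t x + zb x = G x / (2 * g)\<close>. The product \<open>H * u = F' \<lambda>\<close> does not depend
  on \<open>x\<close>, so mass is conserved, and \<open>u * \<partial>\<^sub>x u = - G' / 2\<close> balances \<open>g * \<partial>\<^sub>x (depth + zb) = G' / 2\<close>.
  Since \<open>F 0 - G x\<close> may vanish, \<open>H\<close> can blow up at \<open>\<lambda> = 0\<close>; the fundamental theorem of calculus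
  is therefore applied with differentiability in the interior only.
\<close>

text \<open>The primitive \<open>2 * sqrt (f x)\<close> stays continuous up to the endpoints even if
  \<open>f\<close> vanishes there, while the chain rule is used only where \<open>f\<close> is
  positive. Hence an integrand unbounded near an endpoint is covered.\<close>

lemma has_integral_deriv_div_sqrt:
  fixes f f' :: "real \<Rightarrow> real"
  assumes "a \<le> b"
    and cont: "continuous_on {a..b} f"
    and deriv: "\<And>x. x \<in> {a<..<b} \<Longrightarrow> (f has_real_derivative f' x) (at x)"
    and pos: "\<And>x. x \<in> {a<..<b} \<Longrightarrow> f x > 0"
  shows "((\<lambda>x. f' x / sqrt (f x)) has_integral 2 * sqrt (f b) - 2 * sqrt (f a)) {a..b}"
proof (rule fundamental_theorem_of_calculus_interior[OF \<open>a \<le> b\<close>])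
  show "continuous_on {a..b} (\<lambda>x. 2 * sqrt (f x))"
    by (intro continuous_intros cont)
  show "((\<lambda>x. 2 * sqrt (f x)) has_vector_derivative f' x / sqrt (f x)) (at x)"
    if "x \<in> {a<..<b}" for x
    unfolding has_real_derivative_iff_has_vector_derivative[symmetric]
    by (rule derivative_eq_intros deriv[OF that] refl | use pos[OF that] in \<open>simp add: field_simps\<close>)+
qed

theorem corollary3p2:
  fixes g :: real
    and F F' G zb :: "real \<Rightarrow> real"
    and H u :: "real \<Rightarrow> real \<Rightarrow> real \<Rightarrow> real"
  assumes g_pos: "g > 0"
    and F_deriv: "\<And>l. l \<in> {0..1} \<Longrightarrow> (F has_real_derivative F' l) (at l within {0..1})"
    and F'_cont: "continuous_on {0..1} F'"
    and G_diff: "\<And>x. G differentiable (at x)"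
    and zb_diff: "\<And>x. zb differentiable (at x)"
    and FG_pos: "\<And>x l. l \<in> {0<..<1} \<Longrightarrow> F l - G x > 0"
    and F'_pos: "\<And>l. l \<in> {0<..<1} \<Longrightarrow> F' l > 0"
    and H_eq: "\<And>t x l. l \<in> {0<..<1} \<Longrightarrow> H t x l = F' l / sqrt (F l - G x)"
    and u_eq: "\<And>t x l. l \<in> {0<..<1} \<Longrightarrow> u t x l = sqrt (F l - G x)"
    and zb_eq: "\<And>x. zb x = G x / (2 * g) - 2 * sqrt (F 1 - G x) + 2 * sqrt (F 0 - G x)"
  shows "stationary_solution g zb H u \<and>
    (\<forall>t x. depth H t x = 2 * sqrt (F 1 - G x) - 2 * sqrt (F 0 - G x)) \<and>
    (\<forall>t x. free_surface zb H t x = G x / (2 * g)) \<and>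
    (\<forall>t x. \<forall>l\<in>{0..1}. layer_height zb H t x l =
      G x / (2 * g) + 2 * sqrt (F l - G x) - 2 * sqrt (F 1 - G x))"
proof -
  have F_cont: "continuous_on {0..1} F"
    using F_deriv by (rule DERIV_continuous_on)
  have F_deriv_at: "(F has_real_derivative F' l) (at l)" if "l \<in> {0<..<1}" for l
    using F_deriv[of l] that by (simp add: at_within_Icc_at)
  have int_H: "((\<lambda>m. H t x m) has_integral 2 * sqrt (F l - G x) - 2 * sqrt (F 0 - G x)) {0..l}"
    if l: "l \<in> {0..1}" for t x l
  proof (rule has_integral_spike_finite)
    show "((\<lambda>m. F' m / sqrt (F m - G x)) has_integral
        2 * sqrt (F l - G x) - 2 * sqrt (F 0 - G x)) {0..l}"
    proof (rule has_integral_deriv_div_sqrt)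
      show "continuous_on {0..l} (\<lambda>m. F m - G x)"
        using l by (intro continuous_intros continuous_on_subset[OF F_cont]) auto
      show "((\<lambda>m. F m - G x) has_real_derivative F' m) (at m)" if "m \<in> {0<..<l}" for m
        using that l by (auto intro!: derivative_eq_intros F_deriv_at)
      show "F m - G x > 0" if "m \<in> {0<..<l}" for m
        using that l by (intro FG_pos) auto
    qed (use l in simp)
    \<comment> \<open>\<open>H\<close> is prescribed at interior labels only; the labels 0 and 1
      form the finite exceptional set.\<close>
    show "H t x m = F' m / sqrt (F m - G x)" if "m \<in> {0..l} - {0, 1}" for m
      using that l by (intro H_eq) auto
  qed simp
  have depth: "depth H t x = 2 * sqrt (F 1 - G x) - 2 * sqrt (F 0 - G x)" for t x
    unfolding depth_def using int_H[of 1] by (simp add: integral_unique)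
  \<comment> \<open>This form avoids differentiating \<open>sqrt (F 0 - G x)\<close> where its
    radicand may vanish: smoothness of the depth in \<open>x\<close> is inherited from
    \<open>G\<close> and \<open>zb\<close>.\<close>
  have depth_zb: "depth H t x = G x / (2 * g) - zb x" for t x
    using depth zb_eq by simp
  have abs_int: "(\<lambda>l. H t x l) absolutely_integrable_on {0..1}" for t x
  proof -
    \<comment> \<open>The sign of \<open>H\<close> is known on the open interval only, its endpoint
      values being arbitrary.\<close>
    have "H t x absolutely_integrable_on {0<..<1}"
    proof (rule nonnegative_absolutely_integrable_1)
      show "H t x integrable_on {0<..<1}"
        using int_H[of 1 t x] by (auto simp flip: integrable_on_Icc_iff_Ioo)
      show "H t x l \<ge> 0" if "l \<in> {0<..<1}" for l
        using H_eq[OF that] F'_pos[OF that] FG_pos[OF that, of x] by simp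
    qed
    then show ?thesis
      by (simp add: absolutely_integrable_on_Icc_iff_Ioo)
  qed
  have G_deriv: "(G has_real_derivative deriv G x) (at x)" for x
    using G_diff by (simp add: DERIV_deriv_iff_real_differentiable)
  have zb_deriv: "(zb has_real_derivative deriv zb x) (at x)" for x
    using zb_diff by (simp add: DERIV_deriv_iff_real_differentiable)
  have depth_deriv: "((\<lambda>y. depth H t y) has_real_derivative deriv G x / (2 * g) - deriv zb x) (at x)"
    for t x
    unfolding depth_zb using g_pos by (auto intro!: derivative_eq_intros G_deriv zb_deriv)
  have u_deriv: "((\<lambda>y. u t y l) has_real_derivative - deriv G x / (2 * sqrt (F l - G x))) (at x)"
    if l: "l \<in> {0<..<1}" for t x l
    unfolding u_eq[OF l]
    by (rule derivative_eq_intros G_deriv refl | use FG_pos[OF l, of x] in \<open>simp add: field_simps\<close>)+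
  have H_diff: "(\<lambda>y. H t y l) differentiable (at x)" if l: "l \<in> {0<..<1}" for t x l
  proof -
    \<comment> \<open>The denominator of \<open>H\<close> is \<open>u\<close>, whose derivative is
      known and which is nonzero at interior labels.\<close>
    have "((\<lambda>y. sqrt (F l - G y)) has_real_derivative - deriv G x / (2 * sqrt (F l - G x))) (at x)"
      using u_deriv[OF l] unfolding u_eq[OF l] .
    then have "(\<lambda>y. sqrt (F l - G y)) differentiable (at x)"
      using real_differentiable_def by blast
    then show ?thesis
      unfolding H_eq[OF l] using FG_pos[OF l, of x]
      by (intro differentiable_divide) auto
  qed
  have flux: "H t x l * u t x l = F' l" if l: "l \<in> {0<..<1}" for t x l
    using FG_pos[OF l, of x] by (simp add: H_eq[OF l] u_eq[OF l])
  have momentum: "u t x l * deriv (\<lambda>y. u t y l) x + g * deriv (\<lambda>y. depth H t y) x = - g * deriv zb x"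
    if l: "l \<in> {0<..<1}" for t x l
    unfolding DERIV_imp_deriv[OF u_deriv[OF l]] DERIV_imp_deriv[OF depth_deriv]
    unfolding u_eq[OF l] using FG_pos[OF l, of x] g_pos by (simp add: field_simps)
  have "classical_solution g zb H u"
    unfolding classical_solution_def
  proof (intro allI ballI conjI)
    fix t x l :: real
    assume l: "l \<in> {0<..<1}"
    \<comment> \<open>Rewriting to functions constant in \<open>s\<close> makes the time derivatives
      vanish.\<close>
    have H_const: "(\<lambda>s. H s x l) = (\<lambda>s. H t x l)" and u_const: "(\<lambda>s. u s x l) = (\<lambda>s. u t x l)"
      by (simp_all add: H_eq[OF l] u_eq[OF l])
    show "(\<lambda>s. H s x l) differentiable (at t)" "(\<lambda>s. u s x l) differentiable (at t)"
      by (subst H_const u_const, simp)+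
    show "(\<lambda>y. u t y l) differentiable (at x)"
      using u_deriv[OF l] real_differentiable_def by blast
    show "deriv (\<lambda>s. H s x l) t + deriv (\<lambda>y. H t y l * u t y l) x = 0"
      by (subst H_const) (simp add: flux[OF l])
    show "deriv (\<lambda>s. u s x l) t + u t x l * deriv (\<lambda>y. u t y l) x
        + g * deriv (\<lambda>y. depth H t y) x = - g * deriv zb x"
      by (subst u_const) (simp add: momentum[OF l, simplified])
  qed (use abs_int zb_diff H_diff depth_deriv real_differentiable_def in blast)+
  then have "stationary_solution g zb H u"
    unfolding stationary_solution_def using H_eq u_eq by simp
  \<comment> \<open>The terms with \<open>sqrt (F 0 - G x)\<close> from \<open>zb\<close> and from
    the integral cancel.\<close>
  moreover have "layer_height zb H t x l = G x / (2 * g) + 2 * sqrt (F l - G x) - 2 * sqrt (F 1 - G x)"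
    if "l \<in> {0..1}" for t x l
    unfolding layer_height_def integral_unique[OF int_H[OF that]] zb_eq by simp
  ultimately show ?thesis
    using depth zb_eq by (simp add: free_surface_def)
qed

end
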